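(* Let $n\in\mathbb{N}$. For $n\ge 3$ we have $\mathsf{g}_{\pm}(C_2\oplus C_{2n})=2n+2$. Moreover, $\mathsf{g}_{\pm}(C_2\oplus C_4)=\mathsf{g}_{\pm}(C_2\oplus C_2)=5$.
   Context: For a finite abelian group $G$ (written additively), $\exp(G)$ denotes its exponent and $C_m$ a cyclic group of order $m$. The plus-minus weighted Harborth constant $\mathsf{g}_{\pm}(G)$ is the smallest $\ell\in\mathbb{N}$ such that for every subset $S\subseteq G$ with $|S|\ge\ell$ there exist $\exp(G)$ distinct elements $g_1,\dots,g_{\exp(G)}\in S$ and signs $\varepsilon_1,\dots,\varepsilon_{\exp(G)}\in\{+1,-1\}$ with $\sum_i \varepsilon_i g_i=0$. (If no subset of $G$ has cardinality $\ell$, the condition is vacuously satisfied.) *)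

theory Defs
  imports "HOL-Algebra.Algebra"
begin

text \<open>Groups are the multiplicatively written records of HOL-Algebra: the paper's sum
  \<open>\<epsilon>\<^sub>1 g\<^sub>1 + \<dots> + \<epsilon>\<^sub>k g\<^sub>k\<close> becomes the product of the integer powers \<open>g\<^sub>i [^] \<epsilon>\<^sub>i\<close>,
  and \<open>0\<close> becomes \<open>\<one>\<close>.\<close>

definition group_exponent :: "('a, 'b) monoid_scheme \<Rightarrow> nat" where
  "group_exponent G = (LEAST m. m > 0 \<and> (\<forall>x\<in>carrier G. x [^]\<^bsub>G\<^esub> m = \<one>\<^bsub>G\<^esub>))"

definition has_pm_zero_sum :: "('a, 'b) monoid_scheme \<Rightarrow> nat \<Rightarrow> 'a set \<Rightarrow> bool" where
  "has_pm_zero_sum G k S \<longleftrightarrow>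
     (\<exists>(g :: nat \<Rightarrow> 'a) (\<epsilon> :: nat \<Rightarrow> int).
        inj_on g {1..k} \<and> g ` {1..k} \<subseteq> S \<and> \<epsilon> ` {1..k} \<subseteq> {1, -1} \<and>
        (\<Otimes>\<^bsub>G\<^esub>i\<in>{1..k}. g i [^]\<^bsub>G\<^esub> \<epsilon> i) = \<one>\<^bsub>G\<^esub>)"

text \<open>Meant for finite abelian \<open>G\<close> only: \<open>card\<close> is \<open>0\<close> on infinite sets. The \<open>LEAST\<close> is
  then attained, since every \<open>l > card (carrier G)\<close> satisfies the condition vacuously.\<close>

definition pm_harborth :: "('a, 'b) monoid_scheme \<Rightarrow> nat" where
  "pm_harborth G =
     (LEAST l. \<forall>S. S \<subseteq> carrier G \<and> card S \<ge> l \<longrightarrow> has_pm_zero_sum G (group_exponent G) S)"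

end

(*
  In G = C_2 + C_2m with m >= 2, every 2m-subset T whose sum lies in 2G has a vanishing signed
  sum: flipping the signs on V changes the sum by -2 sum(V), so it suffices that the subset sums of
  the second coordinates of T cover Z/m.  Add elements of T to U as long as each strictly enlarges
  the set A of subset sums mod m.  If A stops short of Z/m, at least m + 2 elements of T are left
  over, and they all lie in the stabiliser dZ/m of A.  Only 4m/d elements of G have second
  coordinate divisible by d, so d < 4, and the few elements of T outside that subgroup make A meet
  every class mod d.  The one exception, T = all elements with even second coordinate, has sum 0 anyway.

  A set S with 2m + 2 elements contains g, h whose removal moves the sum into 2G (otherwise S would
  be disjoint from a translate of itself), and this fails for a suitable set with 2m + 1 elements that
  misses one coset of 2G and whose sum lies in that coset.
*)
theory Submission
  imports Defs
begin

section \<open>Subset sums modulo m\<close>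

text \<open>Summing \<open>f\<close> over sets of indices, not over sets of values, lets two group
  elements with the same second coordinate both contribute.\<close>

definition subset_sums :: "int \<Rightarrow> ('a \<Rightarrow> int) \<Rightarrow> 'a set \<Rightarrow> int set" where
  "subset_sums m f U = (\<lambda>V. (\<Sum>v\<in>V. f v) mod m) ` Pow U"

lemma subset_sumsI: "V \<subseteq> U \<Longrightarrow> (\<Sum>v\<in>V. f v) mod m \<in> subset_sums m f U"
  by (auto simp: subset_sums_def)

lemma subset_sums_subset: "m > 0 \<Longrightarrow> subset_sums m f U \<subseteq> {0..<m}"
  by (auto simp: subset_sums_def)

lemma finite_subset_sums: "m > 0 \<Longrightarrow> finite (subset_sums m f U)"
  by (rule finite_subset[OF subset_sums_subset]) auto

lemma subset_sums_mono: "U \<subseteq> W \<Longrightarrow> subset_sums m f U \<subseteq> subset_sums m f W"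
  by (auto simp: subset_sums_def)

lemma zero_in_subset_sums: "0 \<in> subset_sums m f U"
  using subset_sumsI[of "{}" U f m] by simp

lemma subset_sums_insert:
  assumes "finite U" "y \<notin> U" "a \<in> subset_sums m f U"
  shows "(a + f y) mod m \<in> subset_sums m f (insert y U)"
proof -
  obtain V where V: "V \<subseteq> U" "a = (\<Sum>v\<in>V. f v) mod m"
    using assms by (auto simp: subset_sums_def)
  have "(a + f y) mod m = (\<Sum>v\<in>insert y V. f v) mod m"
    using V assms finite_subset[of V U] by (subst sum.insert) (auto simp: mod_simps add.commute)
  then show ?thesis using V subset_sumsI[of "insert y V" "insert y U" f m] by auto
qed

text \<open>Take \<open>U\<close> maximal among the subsets of \<open>T\<close> with fewer elements
  than subset sums; the empty set qualifies, having the sum 0. If some \<open>y\<close> outside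
  \<open>U\<close> produced a new sum, \<open>insert y U\<close> would gain one element and at least
  one sum, and so would qualify too.\<close>

lemma ex_stabilised_subset_sums:
  assumes "m > 0" "finite T"
  obtains U where "U \<subseteq> T" "card U < card (subset_sums m f U)"
    "\<And>y a. y \<in> T - U \<Longrightarrow> a \<in> subset_sums m f U \<Longrightarrow> (a + f y) mod m \<in> subset_sums m f U"
proof -
  define F where "F = {U. U \<subseteq> T \<and> card U < card (subset_sums m f U)}"
  have "card (subset_sums m f {}) > 0"
    using zero_in_subset_sums[of m f "{}"] finite_subset_sums[OF assms(1), of f "{}"]
    by (auto simp: card_gt_0_iff)
  then have "{} \<in> F" by (simp add: F_def)
  moreover have "finite F" unfolding F_def using assms by simp
  ultimately obtain U where U: "U \<in> F" "\<And>W. W \<in> F \<Longrightarrow> U \<subseteq> W \<Longrightarrow> U = W"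
    using finite_has_maximal[of F] by blast
  have "(a + f y) mod m \<in> subset_sums m f U" if y: "y \<in> T - U" and a: "a \<in> subset_sums m f U" for y a
  proof (rule ccontr)
    assume *: "(a + f y) mod m \<notin> subset_sums m f U"
    have finU: "finite U" using U assms finite_subset by (auto simp: F_def)
    have "subset_sums m f U \<subset> subset_sums m f (insert y U)"
      using * subset_sums_insert[OF finU _ a] y subset_sums_mono[of U "insert y U"] by blast
    then have "card (subset_sums m f U) < card (subset_sums m f (insert y U))"
      by (rule psubset_card_mono[OF finite_subset_sums[OF assms(1)]])
    then have "insert y U \<in> F" using U y finU by (auto simp: F_def)
    then show False using U y by blast
  qed
  then show thesis using that U by (auto simp: F_def)
qed

section \<open>Periods of sets of residues\<close>

text \<open>The translations \<open>D\<close> that map \<open>A\<close> into itself modulo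
  \<open>m\<close> form a subgroup of the integers containing \<open>m\<close>; its least positive
  element \<open>d\<close> generates it.\<close>

lemma ex_period:
  fixes m :: int and A :: "int set"
  assumes "m > 0" "A \<subseteq> {0..<m}"
  obtains d where "d > 0" "d dvd m"
    "\<And>a. a \<in> A \<Longrightarrow> (a + d) mod m \<in> A"
    "\<And>x. (\<And>a. a \<in> A \<Longrightarrow> (a + x) mod m \<in> A) \<Longrightarrow> d dvd x"
proof -
  define D where "D = {x. \<forall>a\<in>A. (a + x) mod m \<in> A}"
  have add: "x + y \<in> D" if "x \<in> D" "y \<in> D" for x y
    using that by (auto simp: D_def mod_simps add.assoc[symmetric]) (metis mod_add_left_eq)
  have mult: "m * k \<in> D" for k
    using assms by (auto simp: D_def subset_iff)
  have nat_mult: "int k * x \<in> D" if "x \<in> D" for x k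
    by (induction k) (use mult[of 0] add that in \<open>auto simp: algebra_simps\<close>)
  \<comment> \<open>Negative multiples come for free: \<open>k\<close> may be replaced by its
    nonnegative residue modulo \<open>m\<close>, because all multiples of \<open>m\<close> lie in
    \<open>D\<close>.\<close>
  have int_mult: "k * x \<in> D" if "x \<in> D" for x k
  proof -
    have "int (nat (k mod m)) * x \<in> D" by (rule nat_mult[OF that])
    then have "(k mod m) * x + m * ((k div m) * x) \<in> D"
      using assms add mult by simp
    also have "(k mod m) * x + m * ((k div m) * x) = k * x"
      by (simp flip: distrib_right mult.assoc)
    finally show ?thesis .
  qed
  define d where "d = (LEAST k. 0 < k \<and> int k \<in> D)"
  have d: "0 < d \<and> int d \<in> D"
    unfolding d_def by (rule LeastI[of _ "nat m"]) (use assms mult[of 1] in auto)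
  have dvd: "int d dvd x" if "x \<in> D" for x
  proof -
    \<comment> \<open>Division with remainder: the remainder lies in \<open>D\<close> and is smaller
      than the least positive element, so it is 0.\<close>
    have "x mod int d = x + (- (x div int d)) * int d"
      by (simp add: minus_div_mult_eq_mod[symmetric])
    also have "\<dots> \<in> D" by (rule add[OF that int_mult]) (use d in simp)
    finally have "int (nat (x mod int d)) \<in> D" using d by simp
    moreover have "nat (x mod int d) < d" using d by (simp add: nat_less_iff)
    ultimately have "nat (x mod int d) = 0" using not_less_Least d_def by blast
    then show ?thesis using d by (simp add: dvd_eq_mod_eq_0) (metis d of_nat_0_less_iff pos_mod_sign order_antisym)
  qed
  show thesis
    by (rule that[of "int d"]) (use d dvd mult[of 1] in \<open>auto simp: D_def\<close>)
qed

lemma periodic_eq_atLeastLessThan: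
  fixes m d :: int
  assumes "d > 0" "d dvd m" "m > 0" "A \<subseteq> {0..<m}"
    and closed: "\<And>a. a \<in> A \<Longrightarrow> (a + d) mod m \<in> A"
    and residues: "\<And>r. r \<in> {0..<d} \<Longrightarrow> \<exists>a\<in>A. a mod d = r"
  shows "A = {0..<m}"
proof -
  have *: "(a + int k * d) mod m \<in> A" if "a \<in> A" for a k
  proof (induction k)
    case 0 then show ?case using that assms by auto
  next
    case (Suc k)
    have "((a + int k * d) mod m + d) mod m = (a + int (Suc k) * d) mod m"
      by (simp add: mod_simps algebra_simps)
    then show ?case using closed[OF Suc.IH] by simp
  qed
  have "z \<in> A" if z: "z \<in> {0..<m}" for z
  proof -
    have "z mod d \<in> {0..<d}" using \<open>d > 0\<close> by simp
    then obtain a where a: "a \<in> A" "a mod d = z mod d" using residues by blast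
    \<comment> \<open>Adding \<open>m\<close> makes the difference positive, so that
      \<open>z\<close> is reached from \<open>a\<close> by forward steps of length \<open>d\<close>
      alone.\<close>
    then have "d dvd z + m - a"
      using assms by (metis mod_eq_dvd_iff dvd_add_left_iff add_diff_eq diff_add_eq)
    then obtain k where k: "z + m - a = d * k" ..
    moreover have "z + m - a > 0" using a assms z by force
    ultimately have "k \<ge> 0" using assms by (simp add: zero_less_mult_iff)
    then have "a + int (nat k) * d = z + m" using k by (simp add: algebra_simps)
    then show ?thesis using *[OF a(1), of "nat k"] z by simp
  qed
  then show ?thesis using assms by auto
qed

lemma card_multiples_atLeastLessThan:
  fixes d q :: int
  assumes "d > 0"
  shows "card {y \<in> {0..<d * q}. d dvd y} = nat q"
proof -
  have "{y \<in> {0..<d * q}. d dvd y} = (\<lambda>j. d * j) ` {0..<q}"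
    using assms by (auto simp: zero_le_mult_iff)
  moreover have "inj_on (\<lambda>j. d * j) {0..<q}" using assms by (auto simp: inj_on_def)
  ultimately show ?thesis by (simp add: card_image)
qed

section \<open>Signed sums of second coordinates\<close>

text \<open>The set excluded by \<open>not_even\<close> has only even subset sums, which miss the
  odd residues when \<open>m\<close> is even.\<close>

lemma subset_sums_snd_eq:
  fixes m :: nat and T :: "(int \<times> int) set"
  assumes m: "m \<ge> 2" and T: "T \<subseteq> {0..<2} \<times> {0..<2 * int m}" "card T = 2 * m"
    and not_even: "T \<noteq> {0..<2} \<times> {y \<in> {0..<2 * int m}. even y}"
  shows "subset_sums (int m) snd T = {0..<int m}"
proof (rule ccontr)
  assume notfull: "subset_sums (int m) snd T \<noteq> {0..<int m}"
  have finT: "finite T" using T(1) by (rule finite_subset) auto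
  have mpos: "int m > 0" using m by simp
  obtain U where U: "U \<subseteq> T" "card U < card (subset_sums (int m) snd U)"
    "\<And>y a. y \<in> T - U \<Longrightarrow> a \<in> subset_sums (int m) snd U \<Longrightarrow> (a + snd y) mod int m \<in> subset_sums (int m) snd U"
    using ex_stabilised_subset_sums[OF mpos finT, of snd] by blast
  define A where "A = subset_sums (int m) snd U"
  have A: "A \<subseteq> {0..<int m}" unfolding A_def by (rule subset_sums_subset[OF mpos])
  have "A \<noteq> {0..<int m}"
    using notfull subset_sums_mono[OF U(1)] subset_sums_subset[OF mpos] unfolding A_def by blast
  then have "card A < m"
    using psubset_card_mono[of "{0..<int m}" A] A by auto
  \<comment> \<open>Two strict inequalities, \<open>card U < card A < m\<close>, leave at least
    \<open>m + 2\<close> of the \<open>2 * m\<close> elements of \<open>T\<close> outside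
    \<open>U\<close>.\<close>
  then have cardU: "card U + 2 \<le> m" using U(2) by (simp add: A_def)
  obtain d where d: "d > 0" "d dvd int m" "\<And>a. a \<in> A \<Longrightarrow> (a + d) mod int m \<in> A"
    "\<And>x. (\<And>a. a \<in> A \<Longrightarrow> (a + x) mod int m \<in> A) \<Longrightarrow> d dvd x"
    using ex_period[OF mpos A] by blast
  obtain q where q: "int m = d * q" using d(2) ..
  then have "q > 0" using d mpos by (simp add: zero_less_mult_iff)
  define R where "R = {0..<2::int} \<times> {y \<in> {0..<2 * int m}. d dvd y}"
  have finR: "finite R"
    by (rule finite_subset[of _ "{0..<2} \<times> {0..<2 * int m}"]) (auto simp: R_def)
  have cardR: "int (card R) = 4 * q"
    using card_multiples_atLeastLessThan[OF d(1), of "2 * q"] \<open>q > 0\<close> q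
    by (simp add: R_def card_cartesian_product mult.left_commute)
  \<comment> \<open>Adding an element of \<open>T - U\<close> preserves \<open>A\<close>, so the
    period \<open>d\<close> divides its second coordinate and the element lies in
    \<open>R\<close>.\<close>
  have outside: "T - R \<subseteq> U"
  proof
    fix y assume y: "y \<in> T - R"
    show "y \<in> U"
    proof (rule ccontr)
      assume "y \<notin> U"
      then have "d dvd snd y" using y U(3)[of y] by (intro d(4)) (auto simp: A_def)
      then show False using y T by (auto simp: R_def)
    qed
  qed
  then have "card (T - U) \<le> card R" by (intro card_mono[OF finR]) auto
  \<comment> \<open>All of \<open>T - U\<close> fits into \<open>R\<close>, which has
    \<open>4 * q\<close> elements; since \<open>m = d * q\<close>, this forces
    \<open>d < 4\<close>.\<close>
  then have "int m + 2 \<le> 4 * q"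
    using cardR cardU T(2) card_Diff_subset[OF finite_subset[OF U(1) finT] U(1)] by linarith
  then have "d * q < 4 * q" using q by linarith
  then have "d < 4" using \<open>q > 0\<close> by simp
  have sums: "\<exists>a\<in>A. a mod d = (\<Sum>v\<in>V. snd v) mod d" if "V \<subseteq> U" for V
    using subset_sumsI[OF that, of snd "int m"] d(2) mod_mod_cancel unfolding A_def by blast
  \<comment> \<open>As \<open>A\<close> is periodic but not everything, it misses a whole class
    \<open>r\<close> modulo \<open>d\<close>. Each of the three possible values of \<open>d\<close>
    contradicts this.\<close>
  obtain r where r: "r \<in> {0..<d}" "\<not> (\<exists>a\<in>A. a mod d = r)"
    using periodic_eq_atLeastLessThan[OF d(1,2) mpos A d(3)] \<open>A \<noteq> {0..<int m}\<close> by blast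
  have "\<exists>a\<in>A. a mod d = 0" using sums[of "{}"] by simp
  consider "d = 1" | "d = 2" | "d = 3" using d(1) \<open>d < 4\<close> by linarith
  then show False
  proof cases
    case 1
    then have "r = 0" using r(1) by auto
    then show False using r(2) \<open>\<exists>a\<in>A. a mod d = 0\<close> by blast
  next
    case 2
    \<comment> \<open>Here \<open>R\<close> is exactly the excluded set and has as many elements as
      \<open>T\<close>, so some element of \<open>T\<close> has odd second coordinate.\<close>
    have "int m = 2 * q" using q 2 by simp
    then have "card T = card R" using T(2) cardR by linarith
    then have "\<not> T \<subseteq> R" using card_subset_eq[OF finR, of T] not_even 2 by (auto simp: R_def)
    then obtain t where t: "t \<in> T - R" by blast
    have "odd (snd t)" using t T 2 by (auto simp: R_def mem_Times_iff)
    then have "snd t mod 2 = 1" by presburger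
    moreover have "t \<in> U" using t outside by auto
    ultimately have "\<exists>a\<in>A. a mod d = 1" using sums[of "{t}"] 2 by simp
    moreover have "r = 0 \<or> r = 1" using r(1) 2 by auto
    ultimately show False using r(2) \<open>\<exists>a\<in>A. a mod d = 0\<close> by blast
  next
    case 3
    \<comment> \<open>At least \<open>6 * q - 4 * q\<close> elements of \<open>T\<close> lie outside
      \<open>R\<close>, hence two. Their residues modulo 3 are either 1 and 2, or equal, and then
      their sum gives the remaining nonzero residue.\<close>
    have "int m = 3 * q" using q 3 by simp
    have "card T \<le> card (T - R) + card R"
      using card_mono[of "(T - R) \<union> R" T] card_Un_le[of "T - R" R] finT finR by auto
    then have "card (T - R) \<ge> 2" using T(2) cardR \<open>int m = 3 * q\<close> \<open>q > 0\<close> by linarith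
    then obtain t t' where t: "t \<in> T - R" "t' \<in> T - R" "t \<noteq> t'"
      using card_le_Suc0_iff_eq[of "T - R"] finT by (metis finite_Diff not_less_eq_eq numeral_2_eq_2)
    have "\<not> 3 dvd snd t" "\<not> 3 dvd snd t'"
      using t T 3 by (auto simp: R_def mem_Times_iff)
    then have mods: "snd t mod 3 \<noteq> 0" "snd t' mod 3 \<noteq> 0" by presburger+
    have tU: "t \<in> U" "t' \<in> U" using t outside by auto
    have "\<exists>a\<in>A. a mod d = snd t mod 3" "\<exists>a\<in>A. a mod d = snd t' mod 3"
      "\<exists>a\<in>A. a mod d = (snd t + snd t') mod 3"
      using sums[of "{t}"] sums[of "{t'}"] sums[of "{t,t'}"] tU t(3) 3 by simp_all
    moreover have "r = 0 \<or> r = snd t mod 3 \<or> r = snd t' mod 3 \<or> r = (snd t + snd t') mod 3"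
    proof -
      have "r = 0 \<or> r = 1 \<or> r = 2" using r(1) 3 by auto
      moreover have "snd t mod 3 = 1 \<or> snd t mod 3 = 2" "snd t' mod 3 = 1 \<or> snd t' mod 3 = 2"
        using mods pos_mod_bound[of 3 "snd t"] pos_mod_sign[of 3 "snd t"]
          pos_mod_bound[of 3 "snd t'"] pos_mod_sign[of 3 "snd t'"] by linarith+
      moreover have "(snd t + snd t') mod 3 = (snd t mod 3 + snd t' mod 3) mod 3"
        by (simp add: mod_simps)
      ultimately show ?thesis by auto
    qed
    ultimately show False using r(2) \<open>\<exists>a\<in>A. a mod d = 0\<close> by blast
  qed
qed

text \<open>If the sum is \<open>2 * s\<close>, flipping the signs on \<open>V\<close> makes it
  divisible by \<open>2 * m\<close> exactly when the sum over \<open>V\<close> is congruent to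
  \<open>s\<close> modulo \<open>m\<close>.\<close>

lemma ex_signed_sum_snd:
  fixes m :: nat and T :: "(int \<times> int) set"
  assumes m: "m \<ge> 2" and T: "T \<subseteq> {0..<2} \<times> {0..<2 * int m}" "card T = 2 * m"
    and even: "even (\<Sum>t\<in>T. snd t)"
  obtains \<epsilon> where "\<epsilon> ` T \<subseteq> {1, -1 :: int}" "2 * int m dvd (\<Sum>t\<in>T. \<epsilon> t * snd t)"
proof -
  have finT: "finite T" using T(1) by (rule finite_subset) auto
  obtain V where V: "V \<subseteq> T" "2 * int m dvd (\<Sum>t\<in>T. snd t) - 2 * (\<Sum>t\<in>V. snd t)"
  proof (cases "T = {0..<2} \<times> {y \<in> {0..<2 * int m}. even y}")
    case True
    have "{y \<in> {0..<2 * int m}. even y} = (\<lambda>j. 2 * j) ` {0..<int m}" by (auto elim!: evenE)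
    then have "(\<Sum>t\<in>T. snd t) = (\<Sum>x\<in>{0..<2::int}. \<Sum>y\<in>(\<lambda>j. 2 * j) ` {0..<int m}. y)"
      unfolding sum.cartesian_product split_def using True by simp
    also have "\<dots> = 2 * (\<Sum>j\<in>{0..<int m}. 2 * j)"
      by (simp add: sum.reindex inj_on_def)
    also have "(\<Sum>j\<in>{0..<int m}. 2 * j) = int m * (int m - 1)"
    proof -
      have "(\<Sum>j\<in>{0..<int k}. 2 * j) = int k * (int k - 1)" for k
      proof (induction k)
        case (Suc k)
        have "{0..<int (Suc k)} = insert (int k) {0..<int k}" by auto
        then show ?case using Suc by (simp add: algebra_simps)
      qed simp
      then show ?thesis .
    qed
    \<comment> \<open>The sum is \<open>2 * m * (m - 1)\<close>, so no sign is flipped.\<close>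
    finally show thesis by (intro that[of "{}"]) auto
  next
    case False
    obtain s where s: "(\<Sum>t\<in>T. snd t) = 2 * s" using even ..
    have "s mod int m \<in> subset_sums (int m) snd T"
      using subset_sums_snd_eq[OF m T False] m by simp
    then obtain V where V: "V \<subseteq> T" "s mod int m = (\<Sum>t\<in>V. snd t) mod int m"
      by (auto simp: subset_sums_def)
    then have "int m dvd s - (\<Sum>t\<in>V. snd t)" by (simp add: mod_eq_dvd_iff)
    then have "2 * int m dvd 2 * (s - (\<Sum>t\<in>V. snd t))" by (rule mult_dvd_mono[OF dvd_refl])
    then show thesis using that V(1) s by (simp add: algebra_simps)
  qed
  define \<epsilon> :: "int \<times> int \<Rightarrow> int" where "\<epsilon> t = (if t \<in> V then -1 else 1)" for t
  have "(\<Sum>t\<in>T. \<epsilon> t * snd t) = (\<Sum>t\<in>T. snd t - 2 * (if t \<in> V then snd t else 0))"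
    by (rule sum.cong) (auto simp: \<epsilon>_def)
  also have "\<dots> = (\<Sum>t\<in>T. snd t) - 2 * (\<Sum>t\<in>V. snd t)"
    using V(1) finT by (simp add: sum_subtractf sum_distrib_left[symmetric] sum.If_cases Int_absorb1)
  finally show thesis using that[of \<epsilon>] V(2) by (auto simp: \<epsilon>_def)
qed

section \<open>Transfer to coordinates\<close>

lemma hom_finprod:
  assumes "comm_group G" "comm_group H" "\<phi> \<in> hom G H" "f \<in> A \<rightarrow> carrier G"
  shows "\<phi> (finprod G f A) = finprod H (\<lambda>x. \<phi> (f x)) A"
proof -
  interpret G: comm_group G by fact
  interpret H: comm_group H by fact
  interpret group_hom G H \<phi> by unfold_locales (use assms in auto)
  show ?thesis using assms(4)
  proof (induction A rule: infinite_finite_induct)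
    case (insert x A)
    then have "f \<in> A \<rightarrow> carrier G" "f x \<in> carrier G" by auto
    moreover from this have "(\<lambda>x. \<phi> (f x)) \<in> A \<rightarrow> carrier H"
      by (auto simp: Pi_iff)
    ultimately show ?case using insert by simp
  qed auto
qed

lemma has_pm_zero_sum_hom_image:
  assumes "comm_group G" "comm_group H" "\<phi> \<in> hom G H" "inj_on \<phi> (carrier G)" "S \<subseteq> carrier G"
    and "has_pm_zero_sum G k S"
  shows "has_pm_zero_sum H k (\<phi> ` S)"
proof -
  interpret G: comm_group G by fact
  interpret H: comm_group H by fact
  interpret group_hom G H \<phi> by unfold_locales (use assms in auto)
  obtain g \<epsilon> where g: "inj_on g {1..k}" "g ` {1..k} \<subseteq> S" "\<epsilon> ` {1..k} \<subseteq> {1, -1 :: int}"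
    "(\<Otimes>\<^bsub>G\<^esub>i\<in>{1..k}. g i [^]\<^bsub>G\<^esub> \<epsilon> i) = \<one>\<^bsub>G\<^esub>"
    using assms(6) unfolding has_pm_zero_sum_def by blast
  have gG: "g i \<in> carrier G" if "i \<in> {1..k}" for i using g(2) assms(5) that by blast
  have "(\<Otimes>\<^bsub>H\<^esub>i\<in>{1..k}. \<phi> (g i) [^]\<^bsub>H\<^esub> \<epsilon> i) = (\<Otimes>\<^bsub>H\<^esub>i\<in>{1..k}. \<phi> (g i [^]\<^bsub>G\<^esub> \<epsilon> i))"
    by (rule H.finprod_cong') (use gG in \<open>auto simp: hom_int_pow\<close>)
  also have "\<dots> = \<phi> (\<Otimes>\<^bsub>G\<^esub>i\<in>{1..k}. g i [^]\<^bsub>G\<^esub> \<epsilon> i)"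
    by (rule hom_finprod[symmetric]) (use gG assms in auto)
  finally have "(\<Otimes>\<^bsub>H\<^esub>i\<in>{1..k}. \<phi> (g i) [^]\<^bsub>H\<^esub> \<epsilon> i) = \<one>\<^bsub>H\<^esub>" using g(4) by simp
  moreover have "inj_on (\<lambda>i. \<phi> (g i)) {1..k}"
    using g(1) gG assms(4) unfolding inj_on_def by blast
  ultimately show ?thesis
    unfolding has_pm_zero_sum_def using g(2,3)
    by (intro exI[of _ "\<lambda>i. \<phi> (g i)"] exI[of _ \<epsilon>]) auto
qed

text \<open>Replaces the indexed family by the set of its members. Injectivity of \<open>g\<close>
  lets the sign of an index be attached to the element itself.\<close>

lemma has_pm_zero_sum_iff:
  assumes "comm_group G" "S \<subseteq> carrier G"
  shows "has_pm_zero_sum G k S \<longleftrightarrow>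
    (\<exists>T \<epsilon>. T \<subseteq> S \<and> finite T \<and> card T = k \<and> \<epsilon> ` T \<subseteq> {1, -1 :: int} \<and>
      (\<Otimes>\<^bsub>G\<^esub>t\<in>T. t [^]\<^bsub>G\<^esub> \<epsilon> t) = \<one>\<^bsub>G\<^esub>)"
proof
  interpret comm_group G by fact
  {
    assume "has_pm_zero_sum G k S"
    then obtain g \<epsilon> where g: "inj_on g {1..k}" "g ` {1..k} \<subseteq> S" "\<epsilon> ` {1..k} \<subseteq> {1, -1 :: int}"
      "(\<Otimes>\<^bsub>G\<^esub>i\<in>{1..k}. g i [^]\<^bsub>G\<^esub> \<epsilon> i) = \<one>\<^bsub>G\<^esub>"
      unfolding has_pm_zero_sum_def by blast
    define \<delta> where "\<delta> t = \<epsilon> (inv_into {1..k} g t)" for t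
    have \<delta>: "\<delta> (g i) = \<epsilon> i" if "i \<in> {1..k}" for i
      using inv_into_f_f[OF g(1) that] by (simp add: \<delta>_def)
    have gG: "g i \<in> carrier G" if "i \<in> {1..k}" for i using g(2) assms(2) that by blast
    have "(\<Otimes>\<^bsub>G\<^esub>t\<in>g ` {1..k}. t [^]\<^bsub>G\<^esub> \<delta> t) = (\<Otimes>\<^bsub>G\<^esub>i\<in>{1..k}. g i [^]\<^bsub>G\<^esub> \<delta> (g i))"
      by (rule finprod_reindex) (use gG g in auto)
    also have "\<dots> = (\<Otimes>\<^bsub>G\<^esub>i\<in>{1..k}. g i [^]\<^bsub>G\<^esub> \<epsilon> i)"
      by (rule finprod_cong') (use gG \<delta> in auto)
    finally show "\<exists>T \<epsilon>. T \<subseteq> S \<and> finite T \<and> card T = k \<and> \<epsilon> ` T \<subseteq> {1, -1 :: int} \<and>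
        (\<Otimes>\<^bsub>G\<^esub>t\<in>T. t [^]\<^bsub>G\<^esub> \<epsilon> t) = \<one>\<^bsub>G\<^esub>"
      using g \<delta> by (intro exI[of _ "g ` {1..k}"] exI[of _ \<delta>]) (auto simp: card_image)
  }
  assume "\<exists>T \<epsilon>. T \<subseteq> S \<and> finite T \<and> card T = k \<and> \<epsilon> ` T \<subseteq> {1, -1 :: int} \<and>
      (\<Otimes>\<^bsub>G\<^esub>t\<in>T. t [^]\<^bsub>G\<^esub> \<epsilon> t) = \<one>\<^bsub>G\<^esub>"
  then obtain T \<epsilon> where T: "T \<subseteq> S" "finite T" "card T = k" "\<epsilon> ` T \<subseteq> {1, -1 :: int}"
    "(\<Otimes>\<^bsub>G\<^esub>t\<in>T. t [^]\<^bsub>G\<^esub> \<epsilon> t) = \<one>\<^bsub>G\<^esub>" by blast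
  obtain g where g: "bij_betw g {1..k} T" using ex_bij_betw_nat_finite_1[OF T(2)] T(3) by blast
  then have img: "g ` {1..k} = T" by (simp add: bij_betw_def)
  have "(\<Otimes>\<^bsub>G\<^esub>t\<in>g ` {1..k}. t [^]\<^bsub>G\<^esub> \<epsilon> t) = (\<Otimes>\<^bsub>G\<^esub>i\<in>{1..k}. g i [^]\<^bsub>G\<^esub> \<epsilon> (g i))"
    by (rule finprod_reindex) (use img T(1) g assms(2) in \<open>auto simp: bij_betw_def subset_iff\<close>)
  moreover have "(\<lambda>i. \<epsilon> (g i)) ` {1..k} \<subseteq> {1, -1}"
    using T(4) unfolding img[symmetric] image_image .
  ultimately show "has_pm_zero_sum G k S"
    unfolding has_pm_zero_sum_def using g T(1,5) img
    by (intro exI[of _ g] exI[of _ "\<lambda>i. \<epsilon> (g i)"]) (simp add: bij_betw_def)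
qed

lemma group_exponent_iso:
  assumes "group G" "group H" "\<phi> \<in> iso G H"
  shows "group_exponent G = group_exponent H"
proof -
  have hom: "\<phi> \<in> hom G H" and bij: "bij_betw \<phi> (carrier G) (carrier H)"
    using assms(3) by (auto simp: iso_def)
  interpret group_hom G H \<phi>
    using assms hom by (simp add: group_hom_def group_hom_axioms_def)
  have "(\<forall>x\<in>carrier G. x [^]\<^bsub>G\<^esub> m = \<one>\<^bsub>G\<^esub>) \<longleftrightarrow> (\<forall>y\<in>carrier H. y [^]\<^bsub>H\<^esub> m = \<one>\<^bsub>H\<^esub>)" for m :: nat
  proof -
    have "x [^]\<^bsub>G\<^esub> m = \<one>\<^bsub>G\<^esub> \<longleftrightarrow> \<phi> x [^]\<^bsub>H\<^esub> m = \<one>\<^bsub>H\<^esub>" if "x \<in> carrier G" for x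
      using that bij hom_one hom_nat_pow[OF that, of m] 
      by (metis G.nat_pow_closed G.one_closed bij_betw_def inj_onD)
    then show ?thesis using bij_betw_ball[OF bij, of "\<lambda>y. y [^]\<^bsub>H\<^esub> m = \<one>\<^bsub>H\<^esub>"] by simp
  qed
  then show ?thesis by (simp add: group_exponent_def)
qed

text \<open>One half of the invariance under isomorphism, to be applied to an isomorphism and to its
  inverse: a subset of \<open>H\<close> is replaced by its preimage, which has the same
  cardinality.\<close>

lemma has_pm_zero_sum_large_subsets_iso:
  assumes "comm_group G" "comm_group H" "\<phi> \<in> iso G H"
    and large: "\<forall>S. S \<subseteq> carrier G \<and> l \<le> card S \<longrightarrow> has_pm_zero_sum G k S"
  shows "\<forall>S. S \<subseteq> carrier H \<and> l \<le> card S \<longrightarrow> has_pm_zero_sum H k S"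
proof (intro allI impI)
  fix S assume S: "S \<subseteq> carrier H \<and> l \<le> card S"
  have hom: "\<phi> \<in> hom G H" and bij: "bij_betw \<phi> (carrier G) (carrier H)"
    using assms(3) by (auto simp: iso_def)
  define S' where "S' = {x \<in> carrier G. \<phi> x \<in> S}"
  have img: "\<phi> ` S' = S" using bij S by (auto simp: S'_def bij_betw_def image_iff)
  have "inj_on \<phi> S'" using bij by (auto simp: bij_betw_def S'_def inj_on_def)
  then have "card S' = card S" using card_image img by metis
  then have "has_pm_zero_sum G k S'" using large S by (auto simp: S'_def)
  then have "has_pm_zero_sum H k (\<phi> ` S')"
    using has_pm_zero_sum_hom_image[OF assms(1,2) hom] bij by (auto simp: bij_betw_def S'_def)
  then show "has_pm_zero_sum H k S" using img by simp
qed

lemma pm_harborth_iso: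
  assumes "comm_group G" "comm_group H" "G \<cong> H"
  shows "pm_harborth G = pm_harborth H"
proof -
  interpret G: comm_group G by fact
  interpret H: comm_group H by fact
  obtain \<phi> where \<phi>: "\<phi> \<in> iso G H" using assms(3) by (auto simp: is_iso_def)
  define \<psi> where "\<psi> = inv_into (carrier G) \<phi>"
  have \<psi>: "\<psi> \<in> iso H G" unfolding \<psi>_def using G.iso_set_sym[OF \<phi>] .
  have "group_exponent G = group_exponent H"
    by (rule group_exponent_iso[OF G.is_group H.is_group \<phi>])
  then show ?thesis
    using has_pm_zero_sum_large_subsets_iso[OF assms(1,2) \<phi>]
      has_pm_zero_sum_large_subsets_iso[OF assms(2,1) \<psi>]
    unfolding pm_harborth_def by (intro arg_cong[of _ _ Least] ext) metis
qed

section \<open>The groups C_2 + C_2m in coordinates\<close>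

lemma finprod_integer_mod_group:
  assumes "f \<in> A \<rightarrow> carrier (integer_mod_group n)"
  shows "finprod (integer_mod_group n) f A = (\<Sum>x\<in>A. f x) mod int n"
proof -
  interpret comm_group "integer_mod_group n" by simp
  show ?thesis using assms
    by (induction A rule: infinite_finite_induct) (auto simp: Pi_iff mod_simps)
qed

lemma comm_group_DirProd:
  assumes "comm_group G" "comm_group H"
  shows "comm_group (G \<times>\<times> H)"
proof -
  interpret G: comm_group G by fact
  interpret H: comm_group H by fact
  show ?thesis
    by (rule group.group_comm_groupI[OF DirProd_group[OF G.is_group H.is_group]])
      (auto simp: G.m_comm H.m_comm)
qed

text \<open>The parameter is half the order of the second factor, so \<open>m = 1\<close>,
  \<open>m = 2\<close> and \<open>m \<ge> 3\<close> are the three cases of the theorem.\<close>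

abbreviation (input) C2_C2m :: "nat \<Rightarrow> (int \<times> int) monoid" where
  "C2_C2m m \<equiv> integer_mod_group 2 \<times>\<times> integer_mod_group (2 * m)"

lemma comm_group_C2_C2m: "comm_group (C2_C2m m)"
  by (intro comm_group_DirProd) auto

text \<open>Positivity matters: for \<open>m = 0\<close> the second factor is the group of all
  integers.\<close>

lemma carrier_C2_C2m: "m > 0 \<Longrightarrow> carrier (C2_C2m m) = {0..<2} \<times> {0..<2 * int m}"
  by (auto simp: carrier_integer_mod_group)

lemma fst_hom_C2_C2m: "fst \<in> hom (C2_C2m m) (integer_mod_group 2)"
  and snd_hom_C2_C2m: "snd \<in> hom (C2_C2m m) (integer_mod_group (2 * m))"
  by (auto simp: hom_def)

lemma int_pow_C2_C2m:
  assumes "x \<in> carrier (C2_C2m m)"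
  shows "x [^]\<^bsub>C2_C2m m\<^esub> (e :: int) = (e * fst x mod 2, e * snd x mod (2 * int m))"
proof -
  interpret comm_group "C2_C2m m" by (rule comm_group_C2_C2m)
  show ?thesis
    using hom_int_pow[OF fst_hom_C2_C2m assms is_group group_integer_mod_group, of e]
      hom_int_pow[OF snd_hom_C2_C2m assms is_group group_integer_mod_group, of e]
    by (auto simp: int_pow_integer_mod_group prod_eq_iff)
qed

lemma nat_pow_C2_C2m:
  assumes "x \<in> carrier (C2_C2m m)"
  shows "x [^]\<^bsub>C2_C2m m\<^esub> (k :: nat) = (int k * fst x mod 2, int k * snd x mod (2 * int m))"
  using int_pow_C2_C2m[OF assms, of "int k"] by (simp add: int_pow_int)

lemma group_exponent_C2_C2m:
  assumes "m > 0"
  shows "group_exponent (C2_C2m m) = 2 * m"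
  unfolding group_exponent_def
proof (rule Least_equality)
  have "x [^]\<^bsub>C2_C2m m\<^esub> (2 * m) = \<one>\<^bsub>C2_C2m m\<^esub>" if "x \<in> carrier (C2_C2m m)" for x
    using nat_pow_C2_C2m[OF that, of "2 * m"] by simp
  moreover have "0 < 2 * m" using assms by simp
  ultimately show "0 < 2 * m \<and> (\<forall>x\<in>carrier (C2_C2m m). x [^]\<^bsub>C2_C2m m\<^esub> (2 * m) = \<one>\<^bsub>C2_C2m m\<^esub>)"
    by blast
next
  fix k :: nat
  assume k: "0 < k \<and> (\<forall>x\<in>carrier (C2_C2m m). x [^]\<^bsub>C2_C2m m\<^esub> k = \<one>\<^bsub>C2_C2m m\<^esub>)"
  \<comment> \<open>This element has order \<open>2 * m\<close>.\<close>
  have "(0, 1) \<in> carrier (C2_C2m m)" using assms by (simp add: carrier_C2_C2m)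
  then have "int k mod (2 * int m) = 0" using k nat_pow_C2_C2m[of "(0,1)" m k] by fastforce
  then have "int (2 * m) dvd int k" by auto
  then show "2 * m \<le> k" using k by (metis of_nat_dvd_iff dvd_imp_le)
qed

lemma finprod_C2_C2m:
  assumes "f \<in> A \<rightarrow> carrier (C2_C2m m)"
  shows "finprod (C2_C2m m) f A =
    ((\<Sum>x\<in>A. fst (f x)) mod 2, (\<Sum>x\<in>A. snd (f x)) mod (2 * int m))"
proof -
  have "fst (finprod (C2_C2m m) f A) = finprod (integer_mod_group 2) (\<lambda>x. fst (f x)) A"
    by (rule hom_finprod[OF comm_group_C2_C2m _ fst_hom_C2_C2m assms]) simp
  moreover have "snd (finprod (C2_C2m m) f A) = finprod (integer_mod_group (2 * m)) (\<lambda>x. snd (f x)) A"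
    by (rule hom_finprod[OF comm_group_C2_C2m _ snd_hom_C2_C2m assms]) simp
  moreover have "(\<lambda>x. fst (f x)) \<in> A \<rightarrow> carrier (integer_mod_group 2)"
    "(\<lambda>x. snd (f x)) \<in> A \<rightarrow> carrier (integer_mod_group (2 * m))"
    using assms by (auto simp: mem_Times_iff Pi_iff)
  ultimately show ?thesis by (simp add: finprod_integer_mod_group prod_eq_iff)
qed

text \<open>A sign change alters a summand by an even number, so parities of signed sums do not
  depend on the signs.\<close>

lemma even_sum_signs_iff:
  fixes f \<epsilon> :: "'a \<Rightarrow> int"
  assumes "\<epsilon> ` T \<subseteq> {1, -1}"
  shows "even (\<Sum>t\<in>T. \<epsilon> t * f t) \<longleftrightarrow> even (\<Sum>t\<in>T. f t)"
  using assms by (induction T rule: infinite_finite_induct) auto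

text \<open>The first coordinate only matters modulo 2, so the signs survive in the second
  coordinate alone.\<close>

lemma has_pm_zero_sum_C2_C2m_iff:
  assumes "m > 0" "S \<subseteq> carrier (C2_C2m m)"
  shows "has_pm_zero_sum (C2_C2m m) k S \<longleftrightarrow>
    (\<exists>T \<epsilon>. T \<subseteq> S \<and> finite T \<and> card T = k \<and> \<epsilon> ` T \<subseteq> {1, -1 :: int} \<and>
      even (\<Sum>t\<in>T. fst t) \<and> 2 * int m dvd (\<Sum>t\<in>T. \<epsilon> t * snd t))"
proof -
  interpret comm_group "C2_C2m m" by (rule comm_group_C2_C2m)
  have "(\<Otimes>\<^bsub>C2_C2m m\<^esub>t\<in>T. t [^]\<^bsub>C2_C2m m\<^esub> \<epsilon> t) = \<one>\<^bsub>C2_C2m m\<^esub> \<longleftrightarrow>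
    even (\<Sum>t\<in>T. fst t) \<and> 2 * int m dvd (\<Sum>t\<in>T. \<epsilon> t * snd t)"
    if T: "T \<subseteq> S" "\<epsilon> ` T \<subseteq> {1, -1 :: int}" for T \<epsilon>
  proof -
    have "(\<lambda>t. t [^]\<^bsub>C2_C2m m\<^esub> \<epsilon> t) \<in> T \<rightarrow> carrier (C2_C2m m)"
      using T assms by (intro funcsetI int_pow_closed) auto
    moreover have "t [^]\<^bsub>C2_C2m m\<^esub> \<epsilon> t = (\<epsilon> t * fst t mod 2, \<epsilon> t * snd t mod (2 * int m))"
      if "t \<in> T" for t
      using that T assms int_pow_C2_C2m[of t m "\<epsilon> t"] by auto
    ultimately have "(\<Otimes>\<^bsub>C2_C2m m\<^esub>t\<in>T. t [^]\<^bsub>C2_C2m m\<^esub> \<epsilon> t) =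
      ((\<Sum>t\<in>T. \<epsilon> t * fst t) mod 2, (\<Sum>t\<in>T. \<epsilon> t * snd t) mod (2 * int m))"
      by (simp add: finprod_C2_C2m mod_sum_eq cong: sum.cong)
    then show ?thesis
      using even_sum_signs_iff[OF T(2), of fst] by (simp add: mod_eq_0_iff_dvd)
  qed
  then have "(T \<subseteq> S \<and> finite T \<and> card T = k \<and> \<epsilon> ` T \<subseteq> {1, -1 :: int} \<and>
      (\<Otimes>\<^bsub>C2_C2m m\<^esub>t\<in>T. t [^]\<^bsub>C2_C2m m\<^esub> \<epsilon> t) = \<one>\<^bsub>C2_C2m m\<^esub>) \<longleftrightarrow>
    (T \<subseteq> S \<and> finite T \<and> card T = k \<and> \<epsilon> ` T \<subseteq> {1, -1 :: int} \<and>
      even (\<Sum>t\<in>T. fst t) \<and> 2 * int m dvd (\<Sum>t\<in>T. \<epsilon> t * snd t))" for T \<epsilon>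
    by blast
  then show ?thesis unfolding has_pm_zero_sum_iff[OF comm_group_C2_C2m assms(2)] by simp
qed

section \<open>The constant for rank two\<close>

text \<open>The two parity conditions say that the sum of \<open>T\<close> lies in 2G.\<close>

lemma has_pm_zero_sum_C2_C2m:
  assumes "m \<ge> 2" "S \<subseteq> carrier (C2_C2m m)" "T \<subseteq> S" "card T = 2 * m"
    and "even (\<Sum>t\<in>T. fst t)" "even (\<Sum>t\<in>T. snd t)"
  shows "has_pm_zero_sum (C2_C2m m) (2 * m) S"
proof -
  have T: "T \<subseteq> {0..<2} \<times> {0..<2 * int m}" using assms carrier_C2_C2m[of m] by auto
  obtain \<epsilon> where "\<epsilon> ` T \<subseteq> {1, -1 :: int}" "2 * int m dvd (\<Sum>t\<in>T. \<epsilon> t * snd t)"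
    using ex_signed_sum_snd[OF assms(1) T assms(4,6)] by blast
  moreover have "finite T" using T by (rule finite_subset) auto
  ultimately show ?thesis
    using assms by (subst has_pm_zero_sum_C2_C2m_iff) auto
qed

lemma card_carrier_C2_C2m: "m > 0 \<Longrightarrow> card (carrier (C2_C2m m)) = 4 * m"
  by (simp add: carrier_C2_C2m card_cartesian_product del: carrier_DirProd)

lemma finite_carrier_C2_C2m: "m > 0 \<Longrightarrow> finite (carrier (C2_C2m m))"
  by (simp add: carrier_C2_C2m del: carrier_DirProd)

text \<open>The pair \<open>(a, b)\<close> stands for the total sum of the set. If it lies in 2G,
  two elements in the same one of the four cosets of 2G do. Otherwise \<open>S\<close> and a
  translate of it each fill more than half of the group, so they meet.\<close>

lemma ex_even_sum_pair:
  fixes a b :: int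
  assumes m: "m \<ge> 2" and S: "S \<subseteq> carrier (C2_C2m m)" "card S \<ge> 2 * m + 2"
  obtains g h where "g \<in> S" "h \<in> S" "g \<noteq> h" "even (a + fst g + fst h)" "even (b + snd g + snd h)"
proof (cases "even a \<and> even b")
  case True
  have "\<not> inj_on (\<lambda>t. (fst t mod 2, snd t mod 2)) S"
  proof
    assume "inj_on (\<lambda>t. (fst t mod 2, snd t mod 2)) S"
    then have "card S \<le> card ({0..<2::int} \<times> {0..<2::int})"
      by (rule card_inj_on_le) auto
    then show False using S(2) m by simp
  qed
  then obtain g h where "g \<in> S" "h \<in> S" "g \<noteq> h" "fst g mod 2 = fst h mod 2" "snd g mod 2 = snd h mod 2"
    by (auto simp: inj_on_def)
  moreover from this have "even (fst g + fst h)" "even (snd g + snd h)" by presburger+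
  ultimately show thesis using that[of g h] True by (simp add: add.assoc)
next
  case False
  interpret comm_group "C2_C2m m" by (rule comm_group_C2_C2m)
  define c where "c = (a mod 2, b mod (2 * int m))"
  \<comment> \<open>\<open>t + \<tau> t\<close> is congruent to the target modulo \<open>2G\<close>, so if no pair works then \<open>S\<close> and \<open>\<tau> ` S\<close> are disjoint.\<close>
  define \<tau> where "\<tau> t = t \<otimes>\<^bsub>C2_C2m m\<^esub> c" for t
  have c: "c \<in> carrier (C2_C2m m)" using m by (simp add: c_def carrier_integer_mod_group)
  have \<tau>: "fst (\<tau> t) = (fst t + a) mod 2" "snd (\<tau> t) = (snd t + b) mod (2 * int m)" for t
    by (simp_all add: \<tau>_def c_def mult_DirProd' mod_simps)
  have par: "even (a + fst t + fst (\<tau> t))" "even (b + snd t + snd (\<tau> t))" for t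
  proof -
    have "even ((snd t + b) mod (2 * int m)) \<longleftrightarrow> even (snd t + b)" by (rule dvd_mod_iff) simp
    then show "even (b + snd t + snd (\<tau> t))" unfolding \<tau> by auto
    show "even (a + fst t + fst (\<tau> t))" unfolding \<tau> by presburger
  qed
  have "inj_on \<tau> (carrier (C2_C2m m))" using c by (auto simp: inj_on_def \<tau>_def simp del: carrier_DirProd mult_DirProd)
  then have "inj_on \<tau> S" using S(1) by (rule inj_on_subset)
  have "S \<inter> \<tau> ` S \<noteq> {}"
  proof
    assume disj: "S \<inter> \<tau> ` S = {}"
    have sub: "S \<union> \<tau> ` S \<subseteq> carrier (C2_C2m m)" using S(1) c by (auto simp: \<tau>_def simp del: carrier_DirProd)
    have fin: "finite S" using S(1) finite_carrier_C2_C2m[of m] m finite_subset by auto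
    have "card (S \<union> \<tau> ` S) = 2 * card S"
      using card_Un_disjoint[OF fin _ disj] fin card_image[OF \<open>inj_on \<tau> S\<close>] by simp
    moreover have "card (S \<union> \<tau> ` S) \<le> 4 * m"
      using card_mono[OF finite_carrier_C2_C2m sub] card_carrier_C2_C2m[of m] m by simp
    ultimately show False using S(2) by simp
  qed
  then obtain t where t: "t \<in> S" "\<tau> t \<in> S" by blast
  \<comment> \<open>Equality would make \<open>a\<close> and \<open>b\<close> both even, by
    \<open>par\<close>.\<close>
  moreover have "t \<noteq> \<tau> t" using par[of t] False by auto
  ultimately show thesis using that par by blast
qed

text \<open>Dropping \<open>g\<close> and \<open>h\<close> from exactly \<open>2 * m + 2\<close>
  elements leaves \<open>2 * m\<close>; modulo 2, removing them has the same effect on the sum as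
  adding them.\<close>

lemma has_pm_zero_sum_C2_C2m_card:
  assumes "m \<ge> 2" "S \<subseteq> carrier (C2_C2m m)" "card S \<ge> 2 * m + 2"
  shows "has_pm_zero_sum (C2_C2m m) (2 * m) S"
proof -
  obtain S' where S': "S' \<subseteq> S" "card S' = 2 * m + 2" "finite S'"
    using obtain_subset_with_card_n[OF assms(3)] by blast
  have "S' \<subseteq> carrier (C2_C2m m)" "card S' \<ge> 2 * m + 2" using S' assms(2) by (blast, simp)
  then obtain g h where g: "g \<in> S'" "h \<in> S'" "g \<noteq> h"
    "even ((\<Sum>t\<in>S'. fst t) + fst g + fst h)" "even ((\<Sum>t\<in>S'. snd t) + snd g + snd h)"
    using ex_even_sum_pair[OF assms(1), of S' "\<Sum>t\<in>S'. fst t" "\<Sum>t\<in>S'. snd t"] by blast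
  have sum: "(\<Sum>t\<in>S'. f t) = (\<Sum>t\<in>S' - {g, h}. f t) + f g + f h" for f :: "int \<times> int \<Rightarrow> int"
    using g S'(3) sum.subset_diff[of "{g, h}" S' f] by simp
  have "even (\<Sum>t\<in>S' - {g, h}. fst t)" "even (\<Sum>t\<in>S' - {g, h}. snd t)"
    using g(4,5) unfolding sum[of fst] sum[of snd] by auto
  moreover have "card (S' - {g, h}) = 2 * m"
    using g S' by (simp add: card_Diff_subset)
  ultimately show ?thesis
    using S'(1) by (intro has_pm_zero_sum_C2_C2m[OF assms(1,2)]) auto
qed

text \<open>It suffices to drop one element lying in the same coset of 2G as the total of five
  elements. If there is none, the five lie in the other three cosets, which have six elements, and
  the sixth would have to lie in the forbidden coset.\<close>

lemma has_pm_zero_sum_C2_C4_card: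
  assumes S: "S \<subseteq> carrier (C2_C2m 2)" "card S \<ge> 5"
  shows "has_pm_zero_sum (C2_C2m 2) 4 S"
proof -
  obtain S' where S': "S' \<subseteq> S" "card S' = 5" "finite S'"
    using obtain_subset_with_card_n[OF S(2)] by blast
  define K where "K = carrier (C2_C2m 2)"
  have K: "K = {(0,0),(0,1),(0,2),(0,3),(1,0),(1,1),(1,2),(1,3)}"
  proof -
    have "{0..<2::int} = {0,1}" "{0..<4::int} = {0,1,2,3}" by auto
    then have "K = {0,1} \<times> {0,1,2,3}"
      using carrier_C2_C2m[of 2] by (simp add: K_def del: carrier_DirProd)
    then show ?thesis by auto
  qed
  have "\<exists>g\<in>S'. even ((\<Sum>t\<in>S'. fst t) + fst g) \<and> even ((\<Sum>t\<in>S'. snd t) + snd g)"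
  proof (rule ccontr)
    assume neg: "\<not> ?thesis"
    define a b where "a = (\<Sum>t\<in>S'. fst t)" and "b = (\<Sum>t\<in>S'. snd t)"
    \<comment> \<open>\<open>W\<close> is the union of three cosets of \<open>2G\<close>; its sum lies in \<open>2G\<close> and \<open>S'\<close> is \<open>W\<close> without one element.\<close>
    define W where "W = {t \<in> K. odd (a + fst t) \<or> odd (b + snd t)}"
    have "S' \<subseteq> W" using neg S' S by (auto simp: W_def K_def a_def b_def)
    have filter_insert: "{t. t \<in> insert x A \<and> P t} = (if P x then insert x {t \<in> A. P t} else {t \<in> A. P t})"
      for x :: "int \<times> int" and A P by auto
    \<comment> \<open>One alternative for each parity pattern of \<open>a\<close> and
      \<open>b\<close>. Every coset contributes two elements, whose sum is in 2G.\<close>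
    have W_explicit: "W = {(0,1),(0,3),(1,0),(1,1),(1,2),(1,3)} \<or>
      W = {(0,0),(0,2),(1,0),(1,1),(1,2),(1,3)} \<or>
      W = {(0,0),(0,1),(0,2),(0,3),(1,1),(1,3)} \<or> W = {(0,0),(0,1),(0,2),(0,3),(1,0),(1,2)}"
      unfolding W_def K
      by (cases "even a"; cases "even b"; simp add: filter_insert del: insert_iff)
    have W: "card W = 6" "even (\<Sum>t\<in>W. fst t)" "even (\<Sum>t\<in>W. snd t)"
      using W_explicit by (elim disjE; simp)+
    have "finite W" by (simp add: W_def K)
    have "card (W - S') = 1" using W(1) S' \<open>S' \<subseteq> W\<close> by (simp add: card_Diff_subset)
    then obtain x where x: "W - S' = {x}" by (auto simp: card_1_singleton_iff)
    have "even (a + fst x)" "even (b + snd x)"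
      using W(2,3) sum.subset_diff[OF \<open>S' \<subseteq> W\<close> \<open>finite W\<close>, of fst]
        sum.subset_diff[OF \<open>S' \<subseteq> W\<close> \<open>finite W\<close>, of snd] x
      by (simp_all add: a_def b_def add.commute)
    then show False using x by (auto simp: W_def)
  qed
  then obtain g where g: "g \<in> S'" "even ((\<Sum>t\<in>S'. fst t) + fst g)" "even ((\<Sum>t\<in>S'. snd t) + snd g)"
    by blast
  then have "even (\<Sum>t\<in>S' - {g}. fst t)" "even (\<Sum>t\<in>S' - {g}. snd t)"
    using S'(3) by (simp_all add: sum.remove)
  then show ?thesis
    using has_pm_zero_sum_C2_C2m[of 2 S "S' - {g}"] S S' g(1) by auto
qed

section \<open>Sets without a vanishing signed sum\<close>

text \<open>A vanishing signed sum over \<open>T\<close> puts the unsigned sum of \<open>T\<close>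
  into 2G. At most one element of \<open>S\<close> is left over, and it would have to carry the odd
  parity of both coordinates of the total, which \<open>avoid\<close> forbids.\<close>

lemma not_has_pm_zero_sum_C2_C2m:
  assumes "m > 0" "S \<subseteq> carrier (C2_C2m m)" "card S \<le> k + 1"
    and odd: "odd (\<Sum>t\<in>S. fst t)" "odd (\<Sum>t\<in>S. snd t)"
    and avoid: "\<And>t. t \<in> S \<Longrightarrow> even (fst t) \<or> even (snd t)"
  shows "\<not> has_pm_zero_sum (C2_C2m m) k S"
proof
  assume "has_pm_zero_sum (C2_C2m m) k S"
  then obtain T \<epsilon> where T: "T \<subseteq> S" "finite T" "card T = k" "\<epsilon> ` T \<subseteq> {1, -1 :: int}"
    "even (\<Sum>t\<in>T. fst t)" "2 * int m dvd (\<Sum>t\<in>T. \<epsilon> t * snd t)"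
    by (auto simp: has_pm_zero_sum_C2_C2m_iff[OF assms(1,2)])
  have "even (\<Sum>t\<in>T. \<epsilon> t * snd t)" using T(6) by (rule dvd_trans[rotated]) simp
  then have ev: "even (\<Sum>t\<in>T. snd t)" using even_sum_signs_iff[OF T(4)] by blast
  \<comment> \<open>Over an infinite set the sum is 0 by convention, hence even.\<close>
  have finS: "finite S" by (rule ccontr) (use odd(1) in simp)
  have "card (S - T) \<le> 1" using card_Diff_subset[OF T(2,1)] T(3) assms(3) by simp
  then consider "S - T = {}" | x where "S - T = {x}"
    using finS by (metis card_0_eq card_1_singletonE finite_Diff le_neq_implies_less less_one)
  then show False
  proof cases
    case 1
    then have "S = T" using T(1) by auto
    then show False using odd T(5) by simp
  next
    case 2
    then have "odd (fst x)" "odd (snd x)"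
      using sum.subset_diff[OF T(1) finS, of fst] sum.subset_diff[OF T(1) finS, of snd] odd T(5) ev by auto
    then show False using avoid[of x] 2 by auto
  qed
qed

text \<open>Take \<open>a\<close> elements of 2G and \<open>q\<close> elements from each of the
  cosets of (0,1) and (1,0). As \<open>q\<close> is odd, both coordinate sums are odd, while the
  coset of (1,1) is missed. A coset has \<open>m\<close> elements, whence the bounds on
  \<open>a\<close> and \<open>q\<close>.\<close>

lemma ex_odd_sum_set:
  assumes "m > 0" "a \<le> m" "q \<le> m" "odd q"
  obtains S where "S \<subseteq> carrier (C2_C2m m)" "card S = a + 2 * q"
    "odd (\<Sum>t\<in>S. fst t)" "odd (\<Sum>t\<in>S. snd t)" "\<And>t. t \<in> S \<Longrightarrow> even (fst t) \<or> even (snd t)"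
proof -
  \<comment> \<open>The first \<open>k\<close> elements of the coset of 2G with first coordinate
    \<open>x\<close> and second coordinates of parity \<open>p\<close>.\<close>
  define Y where "Y x p k = (\<lambda>j. (x, 2 * int j + p)) ` {..<k}" for x p :: int and k :: nat
  have inj: "inj_on (\<lambda>j. (x, 2 * int j + p)) {..<k}" for x p :: int and k
    by (auto simp: inj_on_def)
  have fin: "finite (Y x p k)" for x p k by (simp add: Y_def)
  have card: "card (Y x p k) = k" for x p k by (simp add: Y_def card_image[OF inj])
  have sum_fst: "(\<Sum>t\<in>Y x p k. fst t) = int k * x" for x p k
    by (simp add: Y_def sum.reindex[OF inj])
  have sum_snd: "(\<Sum>t\<in>Y x p k. snd t) = 2 * (\<Sum>j<k. int j) + int k * p" for x p k
    by (simp add: Y_def sum.reindex[OF inj] sum.distrib sum_distrib_left)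
  have disj: "Y 0 0 a \<inter> Y 0 1 q = {}" "(Y 0 0 a \<union> Y 0 1 q) \<inter> Y 1 0 q = {}"
    by (auto simp: Y_def) presburger
  define S where "S = (Y 0 0 a \<union> Y 0 1 q) \<union> Y 1 0 q"
  have sum_S: "(\<Sum>t\<in>S. f t) = (\<Sum>t\<in>Y 0 0 a. f t) + (\<Sum>t\<in>Y 0 1 q. f t) + (\<Sum>t\<in>Y 1 0 q. f t)"
    for f :: "int \<times> int \<Rightarrow> int"
    unfolding S_def using disj fin by (simp add: sum.union_disjoint)
  show thesis
  proof (rule that[of S])
    show "S \<subseteq> carrier (C2_C2m m)"
      using assms by (auto simp: S_def Y_def carrier_C2_C2m simp del: carrier_DirProd)
    show "card S = a + 2 * q"
      unfolding S_def using disj fin by (simp add: card_Un_disjoint card)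
    show "odd (\<Sum>t\<in>S. fst t)" "odd (\<Sum>t\<in>S. snd t)"
      using assms(4) by (simp_all add: sum_S sum_fst sum_snd)
    show "even (fst t) \<or> even (snd t)" if "t \<in> S" for t
      using that by (auto simp: S_def Y_def)
  qed
qed

section \<open>Values of the constant\<close>

lemma pm_harborth_eqI:
  assumes "\<And>S. S \<subseteq> carrier G \<Longrightarrow> card S \<ge> l \<Longrightarrow> has_pm_zero_sum G (group_exponent G) S"
    and "S \<subseteq> carrier G" "card S + 1 = l" "\<not> has_pm_zero_sum G (group_exponent G) S"
  shows "pm_harborth G = l"
  unfolding pm_harborth_def
proof (rule Least_equality)
  fix l' assume "\<forall>S. S \<subseteq> carrier G \<and> card S \<ge> l' \<longrightarrow> has_pm_zero_sum G (group_exponent G) S"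
  then have "\<not> l' \<le> card S" using assms by blast
  then show "l \<le> l'" using assms by simp
qed (use assms in blast)

lemma pm_harborth_C2_C2m:
  assumes "m \<ge> 3"
  shows "pm_harborth (C2_C2m m) = 2 * m + 2"
proof -
  \<comment> \<open>With \<open>q\<close> odd and at most \<open>m\<close>, the largest choice is
    \<open>m\<close> or \<open>m - 1\<close>. For even \<open>m\<close> this requires
    \<open>a = 3 \<le> m\<close>, which is where \<open>m = 2\<close> behaves differently.\<close>
  obtain a q where aq: "a \<le> m" "q \<le> m" "odd q" "a + 2 * q = 2 * m + 1"
  proof (cases "odd m")
    case True
    then show thesis using that[of 1 m] assms by simp
  next
    case False
    then show thesis using that[of 3 "m - 1"] assms by simp
  qed
  obtain S where S: "S \<subseteq> carrier (C2_C2m m)" "card S = a + 2 * q"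
    "odd (\<Sum>t\<in>S. fst t)" "odd (\<Sum>t\<in>S. snd t)" "\<And>t. t \<in> S \<Longrightarrow> even (fst t) \<or> even (snd t)"
    using ex_odd_sum_set[OF _ aq(1-3)] assms by (metis gr0I not_numeral_le_zero)
  have exponent: "group_exponent (C2_C2m m) = 2 * m" using group_exponent_C2_C2m assms by simp
  show ?thesis
  proof (rule pm_harborth_eqI)
    show "\<not> has_pm_zero_sum (C2_C2m m) (group_exponent (C2_C2m m)) S"
      unfolding exponent
      by (rule not_has_pm_zero_sum_C2_C2m) (use S aq assms in \<open>auto simp del: carrier_DirProd\<close>)
  qed (use S aq has_pm_zero_sum_C2_C2m_card exponent assms in \<open>auto simp del: carrier_DirProd\<close>)
qed

lemma pm_harborth_C2_C4: "pm_harborth (C2_C2m 2) = 5"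
proof -
  \<comment> \<open>Only four elements here, as many as the exponent, so \<open>S\<close> itself is
    the only candidate for a vanishing signed sum.\<close>
  obtain S where S: "S \<subseteq> carrier (C2_C2m 2)" "card S = 2 + 2 * 1"
    "odd (\<Sum>t\<in>S. fst t)" "odd (\<Sum>t\<in>S. snd t)" "\<And>t. t \<in> S \<Longrightarrow> even (fst t) \<or> even (snd t)"
    using ex_odd_sum_set[of 2 2 1] by auto
  have exponent: "group_exponent (C2_C2m 2) = 4" using group_exponent_C2_C2m[of 2] by simp
  show ?thesis
  proof (rule pm_harborth_eqI)
    show "\<not> has_pm_zero_sum (C2_C2m 2) (group_exponent (C2_C2m 2)) S"
      unfolding exponent
      by (rule not_has_pm_zero_sum_C2_C2m) (use S in \<open>auto simp del: carrier_DirProd\<close>)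
  qed (use S has_pm_zero_sum_C2_C4_card exponent in \<open>auto simp del: carrier_DirProd\<close>)
qed

text \<open>Every element is its own inverse, so two distinct elements never have a vanishing signed
  sum, and the whole group is a counterexample of size 4. For size 5 the condition is
  vacuous.\<close>

lemma pm_harborth_C2_C2: "pm_harborth (C2_C2m 1) = 5"
proof (rule pm_harborth_eqI)
  have exponent: "group_exponent (C2_C2m 1) = 2" using group_exponent_C2_C2m[of 1] by simp
  show "\<not> has_pm_zero_sum (C2_C2m 1) (group_exponent (C2_C2m 1)) (carrier (C2_C2m 1))"
  proof
    assume "has_pm_zero_sum (C2_C2m 1) (group_exponent (C2_C2m 1)) (carrier (C2_C2m 1))"
    then obtain T \<epsilon> where T: "T \<subseteq> carrier (C2_C2m 1)" "card T = 2" "\<epsilon> ` T \<subseteq> {1, -1 :: int}"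
      "even (\<Sum>t\<in>T. fst t)" "2 * int 1 dvd (\<Sum>t\<in>T. \<epsilon> t * snd t)"
      unfolding exponent by (subst (asm) has_pm_zero_sum_C2_C2m_iff) auto
    have "even (\<Sum>t\<in>T. snd t)" using T(3,5) even_sum_signs_iff[of \<epsilon> T snd] by simp
    moreover obtain s t where st: "T = {s, t}" "s \<noteq> t" using T(2) by (auto simp: card_2_iff)
    ultimately have "even (fst s + fst t)" "even (snd s + snd t)" using T(4) by simp_all
    moreover have "fst s \<in> {0,1}" "fst t \<in> {0,1}" "snd s \<in> {0,1}" "snd t \<in> {0,1}"
      using T(1) st by (auto simp: mem_Times_iff carrier_integer_mod_group)
    ultimately show False using st(2) by (auto simp: prod_eq_iff)
  qed
  show "has_pm_zero_sum (C2_C2m 1) (group_exponent (C2_C2m 1)) S"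
    if "S \<subseteq> carrier (C2_C2m 1)" "5 \<le> card S" for S
    using card_mono[OF finite_carrier_C2_C2m that(1)] card_carrier_C2_C2m[of 1] that(2) by simp
qed (use card_carrier_C2_C2m[of 1] in \<open>auto simp del: carrier_DirProd\<close>)

theorem theorem1p3:
  fixes G :: "('a, 'b) monoid_scheme"
    and n :: nat
  assumes "comm_group G"
  shows "(n \<ge> 3 \<and> G \<cong> integer_mod_group 2 \<times>\<times> integer_mod_group (2 * n)
            \<longrightarrow> pm_harborth G = 2 * n + 2) \<and>
         (G \<cong> integer_mod_group 2 \<times>\<times> integer_mod_group 4 \<longrightarrow> pm_harborth G = 5) \<and>
         (G \<cong> integer_mod_group 2 \<times>\<times> integer_mod_group 2 \<longrightarrow> pm_harborth G = 5)"
proof -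
  have iso: "pm_harborth G = pm_harborth (C2_C2m m)" if "G \<cong> C2_C2m m" for m
    by (rule pm_harborth_iso[OF assms comm_group_C2_C2m that])
  show ?thesis
    using iso[of n] iso[of 2] iso[of 1] pm_harborth_C2_C2m[of n] pm_harborth_C2_C4 pm_harborth_C2_C2
    by simp
qed

end
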